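(* For all integers $k\ge3$ we have $$\zeta(k)=2^{k-1}\sum_{\substack{r+s=k\\ r\ge1,\,s\ge2}}\hat\zeta(r,s).$$
   Context: $\zeta$ is the Riemann zeta function, and the modified double zeta values are $\hat\zeta(r,s)=\sum_{0<m<n}\frac{1}{(m+n)^rn^s}$ for integers $r\ge1$, $s\ge2$. *)

theory Defs
  imports "HOL-Analysis.Analysis"
begin

text \<open>The Riemann zeta function in the half-plane \<open>Re s > 1\<close>, where it is given by its
  (absolutely convergent) Dirichlet series. The analytic continuation is not represented: outside
  this half-plane the value below has no mathematical meaning.\<close>

definition zeta :: "complex \<Rightarrow> complex" where
  "zeta s = (\<Sum>\<^sub>\<infinity>n\<in>{1::nat..}. 1 / (of_nat n powr s))"

text \<open>Modified double zeta values, meant for \<open>r \<ge> 1\<close> and \<open>s \<ge> 2\<close>, where the double series of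
  positive terms converges, so that the unordered sum over pairs agrees with any iterated sum.\<close>

definition mod_double_zeta :: "nat \<Rightarrow> nat \<Rightarrow> real" where
  "mod_double_zeta r s =
     (\<Sum>\<^sub>\<infinity>(m, n)\<in>{(m::nat, n::nat). 0 < m \<and> m < n}. 1 / (real (m + n) ^ r * real n ^ s))"

end

theory Submission
  imports Defs
begin

text \<open>For \<open>0 < m < n\<close> and \<open>N = m + n\<close> the inner geometric sum over \<open>r\<close> collapses to
  \<open>1 / (m n\<^sup>k\<^sup>-\<^sup>1) - 1 / (m N\<^sup>k\<^sup>-\<^sup>1) - 1 / (n N\<^sup>k\<^sup>-\<^sup>1)\<close>. Write \<open>g m N = 1 / (m N\<^sup>k\<^sup>-\<^sup>1)\<close>. The first term
  sums \<open>g\<close> over all pairs \<open>0 < m < N\<close>, the other two sum it over the pairs with \<open>2 m < N\<close> and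
  with \<open>2 m > N\<close>. What survives is the diagonal \<open>N = 2 m\<close>, which contributes
  \<open>\<zeta>(k) / 2\<^sup>k\<^sup>-\<^sup>1\<close>.\<close>

lemma has_sum_sum:
  fixes f :: "'i \<Rightarrow> 'a \<Rightarrow> 'b :: topological_comm_monoid_add"
  assumes "\<And>i. i \<in> I \<Longrightarrow> (f i has_sum S i) A"
  shows "((\<lambda>x. \<Sum>i\<in>I. f i x) has_sum (\<Sum>i\<in>I. S i)) A"
  using assms by (induction I rule: infinite_finite_induct) (auto intro!: has_sum_add)

text \<open>The sum is geometric with closed form
  \<open>1 / (x * y ^ (l + 1)) - 1 / (x * y * (x + y) ^ l)\<close>, which is what the induction
  proves. Since \<open>1 / x + 1 / y = (x + y) / (x * y)\<close>, the subtracted term then splits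
  into the last two fractions.\<close>

lemma inverse_add_weighted_power_sum:
  fixes x y :: "'a :: field"
  assumes "x \<noteq> 0" "y \<noteq> 0" "x + y \<noteq> 0"
  shows "(\<Sum>r=1..l. 1 / ((x + y) ^ r * y ^ (l + 2 - r))) =
    1 / (x * y ^ (l + 1)) - 1 / (x * (x + y) ^ (l + 1)) - 1 / (y * (x + y) ^ (l + 1))"
proof -
  have *: "1 / (x * (x + y) ^ (l + 1)) + 1 / (y * (x + y) ^ (l + 1)) = 1 / (x * y * (x + y) ^ l)" for l
    using assms by (simp add: divide_simps)
  have "(\<Sum>r=1..l. 1 / ((x + y) ^ r * y ^ (l + 2 - r))) =
    1 / (x * y ^ (l + 1)) - 1 / (x * y * (x + y) ^ l)"
  proof (induction l)
    case (Suc l)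
    \<comment> \<open>Passing from \<open>l\<close> to \<open>Suc l\<close> divides every old term
      by \<open>y\<close>; the new term \<open>r = Suc l\<close> is written as a difference so that
      the sum telescopes.\<close>
    have "(\<Sum>r=1..l. 1 / ((x + y) ^ r * y ^ (Suc l + 2 - r))) =
      (\<Sum>r=1..l. 1 / ((x + y) ^ r * y ^ (l + 2 - r))) / y"
      unfolding sum_divide_distrib by (intro sum.cong refl) (simp add: Suc_diff_le)
    moreover have "1 / ((x + y) ^ Suc l * y ^ 2) = 1 / (x * y * (x + y) ^ l) / y - 1 / (x * y * (x + y) ^ Suc l)"
      using assms by (simp add: divide_simps) (simp add: algebra_simps power2_eq_square)
    ultimately show ?case
      using Suc by (simp add: diff_divide_distrib mult_ac)
  qed simp
  with *[of l] show ?thesis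
    by (simp add: algebra_simps)
qed

text \<open>The factor \<open>1 / m\<close> alone gives a divergent series, so decay is shifted from
  \<open>n\<close> to \<open>m\<close>: as \<open>m < n\<close>, the term for \<open>q = 2\<close>
  is at most \<open>(m * n) powr (-3/2)\<close>, a product of terms of two convergent
  series.\<close>

lemma summable_on_inverse_mult_power:
  fixes q :: nat
  assumes "q \<ge> 2"
  shows "(\<lambda>(m, n). 1 / (real m * real n ^ q)) summable_on {(m, n). 0 < m \<and> m < n}"
proof (rule summable_on_comparison_test)
  have "summable (\<lambda>n. real n powr (-3/2))"
    by (simp add: summable_real_powr_iff)
  then have "(\<lambda>n. real n powr (-3/2)) summable_on UNIV"
    by (intro norm_summable_imp_summable_on) simp
  then have "(\<lambda>(m, n). real m powr (-3/2) * real n powr (-3/2)) summable_on UNIV \<times> UNIV"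
    by (intro summable_on_SigmaI[where g = "\<lambda>m. real m powr (-3/2) * (\<Sum>\<^sub>\<infinity>n. real n powr (-3/2))"])
      (auto intro: has_sum_cmult_right summable_on_cmult_left)
  then show "(\<lambda>(m, n). real m powr (-3/2) * real n powr (-3/2)) summable_on {(m, n). 0 < m \<and> m < n}"
    by (rule summable_on_subset_banach) auto
next
  fix p :: "nat \<times> nat"
  assume p: "p \<in> {(m, n). 0 < m \<and> m < n}"
  obtain m n where [simp]: "p = (m, n)" by (cases p)
  have mn: "0 < m" "m < n" using p by auto
  have "1 / (real m * real n ^ q) \<le> 1 / (real m * real n ^ 2)"
    using mn assms by (intro divide_left_mono mult_left_mono power_increasing) auto
  also have "\<dots> = real m powr (-3/2) * real n powr (-3/2) * (real m powr (1/2) * real n powr (-1/2))"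
  proof -
    have "real m powr (-3/2) * real m powr (1/2) = 1 / real m"
      "real n powr (-3/2) * real n powr (-1/2) = 1 / real n ^ 2"
      using mn by (simp_all only: powr_add[symmetric]) (simp_all add: powr_minus_divide powr_numeral)
    then show ?thesis by (simp add: mult_ac)
  qed
  also have "\<dots> \<le> real m powr (-3/2) * real n powr (-3/2) * 1"
  proof (intro mult_left_mono)
    have "real m powr (1/2) * real n powr (-1/2) \<le> real n powr (1/2) * real n powr (-1/2)"
      using mn by (intro mult_right_mono powr_mono2) auto
    then show "real m powr (1/2) * real n powr (-1/2) \<le> 1"
      using mn by (simp only: powr_add[symmetric]) simp
  qed simp
  finally show "(case p of (m, n) \<Rightarrow> 1 / (real m * real n ^ q)) \<le>
      (case p of (m, n) \<Rightarrow> real m powr (-3/2) * real n powr (-3/2))"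
    by simp
qed auto

text \<open>One of the \<open>r\<close> factors \<open>m + n\<close> is bounded below by
  \<open>m\<close>, the others by \<open>n\<close>. This leaves \<open>m * n ^ (r + s - 1)\<close>,
  whose exponent is at least 2.\<close>

lemma mod_double_zeta_has_sum:
  assumes "r \<ge> 1" "s \<ge> 1" "r + s \<ge> 3"
  shows "((\<lambda>(m, n). 1 / (real (m + n) ^ r * real n ^ s)) has_sum mod_double_zeta r s)
    {(m, n). 0 < m \<and> m < n}"
  unfolding mod_double_zeta_def
proof (rule has_sum_infsum, rule summable_on_comparison_test)
  show "(\<lambda>(m, n). 1 / (real m * real n ^ (r + s - 1))) summable_on {(m, n). 0 < m \<and> m < n}"
    using assms by (intro summable_on_inverse_mult_power) auto
next
  fix p :: "nat \<times> nat"
  assume p: "p \<in> {(m, n). 0 < m \<and> m < n}"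
  obtain m n where [simp]: "p = (m, n)" by (cases p)
  have mn: "0 < m" "m < n" using p by auto
  obtain r' where r: "r = Suc r'" using assms by (cases r) auto
  have "real m * real n ^ r' * real n ^ s \<le> real (m + n) * real (m + n) ^ r' * real n ^ s"
    by (intro mult_mono power_mono) auto
  then have "real m * real n ^ (r + s - 1) \<le> real (m + n) ^ r * real n ^ s"
    by (simp add: r power_add mult_ac)
  then show "(case p of (m, n) \<Rightarrow> 1 / (real (m + n) ^ r * real n ^ s)) \<le>
      (case p of (m, n) \<Rightarrow> 1 / (real m * real n ^ (r + s - 1)))"
    using mn by (auto intro!: divide_left_mono)
qed auto

text \<open>Supplies a real witness for the zeta value, so that the main argument stays within real
  sums and ordinary powers.\<close>

lemma zeta_of_nat_has_sum:
  fixes k :: nat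
  assumes "k \<ge> 2"
  obtains z where "zeta (of_nat k) = complex_of_real z" "((\<lambda>n. 1 / real n ^ k) has_sum z) {1..}"
proof
  have "summable (\<lambda>n. 1 / real n ^ k)"
    using inverse_power_summable[of k, where ?'a = real] assms by (simp add: field_simps)
  then have "(\<lambda>n. 1 / real n ^ k) summable_on {1..}"
    by (intro summable_on_subset_banach[OF norm_summable_imp_summable_on]) auto
  then show *: "((\<lambda>n. 1 / real n ^ k) has_sum infsum (\<lambda>n. 1 / real n ^ k) {1..}) {1..}"
    by (rule has_sum_infsum)
  have "((\<lambda>n. complex_of_real (1 / real n ^ k)) has_sum
      complex_of_real (infsum (\<lambda>n. 1 / real n ^ k) {1..})) {1..}"
    using has_sum_of_real[OF *] .
  also have "?this \<longleftrightarrow> ((\<lambda>n. 1 / (of_nat n powr of_nat k)) has_sum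
      complex_of_real (infsum (\<lambda>n. 1 / real n ^ k) {1..})) {1::nat..}"
    by (intro has_sum_cong) (auto simp: powr_nat)
  finally show "zeta (of_nat k) = complex_of_real (infsum (\<lambda>n. 1 / real n ^ k) {1..})"
    unfolding zeta_def by (rule infsumI)
qed

theorem theorem1p4:
  fixes k :: nat
  assumes "k \<ge> 3"
  shows "zeta (of_nat k) =
    2 ^ (k - 1) * complex_of_real
      (\<Sum>(r, s)\<in>{(r::nat, s::nat). r + s = k \<and> r \<ge> 1 \<and> s \<ge> 2}. mod_double_zeta r s)"
proof -
  define T :: "(nat \<times> nat) set" where "T = {(m, n). 0 < m \<and> m < n}"
  define g :: "nat \<times> nat \<Rightarrow> real" where "g = (\<lambda>(m, n). 1 / (real m * real n ^ (k - 1)))"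
  let ?lo = "(\<lambda>(m, n). (m, m + n)) :: nat \<times> nat \<Rightarrow> _"
  let ?hi = "(\<lambda>(m, n). (n, m + n)) :: nat \<times> nat \<Rightarrow> _"
  let ?di = "(\<lambda>n. (n, 2 * n)) :: nat \<Rightarrow> _"
  obtain z where z: "zeta (of_nat k) = complex_of_real z" "((\<lambda>n. 1 / real n ^ k) has_sum z) {1..}"
    using zeta_of_nat_has_sum assms by (metis Suc_leD eval_nat_numeral(3))
  have inj: "inj_on ?lo T" "inj_on ?hi T" "inj_on ?di {1..}"
    by (auto simp: inj_on_def)
  \<comment> \<open>A pair \<open>(a, N)\<close> in \<open>T\<close> decomposes \<open>N\<close> as
    \<open>a + (N - a)\<close>; the three images collect the cases where \<open>a\<close> is the
    smaller part, the larger part, or exactly half of \<open>N\<close>.\<close>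
  have split: "T = ?lo ` T \<union> ?hi ` T \<union> ?di ` {1..}"
  proof (intro equalityI subsetI)
    fix p assume "p \<in> T"
    then obtain m n where p: "p = (m, n)" "0 < m" "m < n" by (auto simp: T_def)
    consider "2 * m < n" | "2 * m > n" | "n = 2 * m" by linarith
    then show "p \<in> ?lo ` T \<union> ?hi ` T \<union> ?di ` {1..}"
    proof cases
      case 1
      then have "p = ?lo (m, n - m)" "(m, n - m) \<in> T" using p by (auto simp: T_def)
      then show ?thesis by blast
    next
      case 2
      then have "p = ?hi (n - m, m)" "(n - m, m) \<in> T" using p by (auto simp: T_def)
      then show ?thesis by blast
    qed (use p in auto)
  qed (auto simp: T_def)
  have summ: "g summable_on A" if "A \<subseteq> T" for A
    using summable_on_inverse_mult_power[of "k - 1"] that assms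
    unfolding g_def T_def by (auto intro: summable_on_subset_banach[rotated])
  \<comment> \<open>These two values are never computed: only their existence matters, since they
    cancel at the end.\<close>
  have lo: "(g has_sum infsum g (?lo ` T)) (?lo ` T)"
    and hi: "(g has_sum infsum g (?hi ` T)) (?hi ` T)"
    by (intro has_sum_infsum summ; use split in blast)+
  have "((\<lambda>n. 1 / 2 ^ (k - 1) * (1 / real n ^ k)) has_sum 1 / 2 ^ (k - 1) * z) {1..}"
    using z(2) by (rule has_sum_cmult_right)
  also have "?this \<longleftrightarrow> ((g \<circ> ?di) has_sum 1 / 2 ^ (k - 1) * z) {1..}"
  proof (intro has_sum_cong)
    fix n :: nat
    have "real n ^ k = real n * real n ^ (k - 1)"
      using assms by (simp add: power_eq_if[of _ k])
    then show "1 / 2 ^ (k - 1) * (1 / real n ^ k) = (g \<circ> ?di) n"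
      by (simp add: g_def power_mult_distrib)
  qed
  finally have di: "(g has_sum 1 / 2 ^ (k - 1) * z) (?di ` {1..})"
    using inj(3) by (simp add: has_sum_reindex)
  have "(g has_sum (infsum g (?lo ` T) + infsum g (?hi ` T) + 1 / 2 ^ (k - 1) * z))
      (?lo ` T \<union> ?hi ` T \<union> ?di ` {1..})"
    by (intro has_sum_Un_disjoint lo hi di) (auto simp: T_def)
  then have total: "(g has_sum (infsum g (?lo ` T) + infsum g (?hi ` T) + 1 / 2 ^ (k - 1) * z)) T"
    by (simp only: split[symmetric])
  have lo': "((g \<circ> ?lo) has_sum infsum g (?lo ` T)) T" and hi': "((g \<circ> ?hi) has_sum infsum g (?hi ` T)) T"
    using lo hi inj by (simp_all add: has_sum_reindex)
  \<comment> \<open>The bound \<open>r \<le> k - 2\<close> encodes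
    \<open>s = k - r \<ge> 2\<close>.\<close>
  have "((\<lambda>p. \<Sum>r=1..k-2. case p of (m, n) \<Rightarrow> 1 / (real (m + n) ^ r * real n ^ (k - r)))
      has_sum (\<Sum>r=1..k-2. mod_double_zeta r (k - r))) T"
    using assms unfolding T_def by (intro has_sum_sum mod_double_zeta_has_sum) auto
  from has_sum_add[OF has_sum_add[OF this lo'] hi']
  \<comment> \<open>The finite identity with \<open>l = k - 2\<close>, its negative terms moved to
    the other side, recovers \<open>g\<close> pointwise. Comparing with \<open>total\<close> leaves
    only the diagonal contribution.\<close>
  have "(g has_sum ((\<Sum>r=1..k-2. mod_double_zeta r (k - r)) + infsum g (?lo ` T) + infsum g (?hi ` T))) T"
  proof (rule has_sum_cong[THEN iffD1, rotated])
    fix p assume "p \<in> T"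
    then obtain m n where p: "p = (m, n)" "0 < m" "m < n" by (auto simp: T_def)
    have "Suc (k - 2) = k - 1" "k - 2 + 2 = k" using assms by auto
    then show "(\<Sum>r=1..k-2. case p of (m, n) \<Rightarrow> 1 / (real (m + n) ^ r * real n ^ (k - r))) +
        (g \<circ> ?lo) p + (g \<circ> ?hi) p = g p"
      using inverse_add_weighted_power_sum[of "real m" "real n" "k - 2"] p
      by (simp add: g_def del: sum.cl_ivl_Suc)
  qed
  from has_sum_unique[OF this total]
  have "(\<Sum>r=1..k-2. mod_double_zeta r (k - r)) = 1 / 2 ^ (k - 1) * z"
    by simp
  moreover have "(\<Sum>(r, s)\<in>{(r, s). r + s = k \<and> r \<ge> 1 \<and> s \<ge> 2}. mod_double_zeta r s) =
      (\<Sum>r=1..k-2. mod_double_zeta r (k - r))"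
    using assms by (intro sum.reindex_bij_witness[of _ "\<lambda>r. (r, k - r)" fst]) auto
  ultimately show ?thesis
    by (simp add: z(1))
qed

end
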